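(* Let $p>5$ be a prime. Then $$\sum_{k=0}^{p-1}2^k\binom{3k}{k}\equiv\frac{6(-1)^{(p-1)/2}-1}{5}\pmod p$$ and $$\sum_{k=0}^{p-1}2^k\binom{3k+1}{k}\equiv\frac{4(-1)^{(p-1)/2}+1}{5}\pmod p.$$
   Context: Congruences modulo $p$ between rational numbers whose denominators are prime to $p$ are understood in the ring of rationals with denominator prime to $p$ (i.e. $a\equiv b \pmod p$ means that $a-b$ is $p$ times such a rational). *)

theory Defs
  imports "HOL-Number_Theory.Number_Theory"
begin

text \<open>The ring of rationals with denominator prime to \<open>p\<close>; \<^const>\<open>quotient_of\<close> returns
  the numerator and the (positive) denominator in lowest terms.\<close>

definition rats_prime_to :: "nat \<Rightarrow> rat set" where
  "rats_prime_to p = {r. coprime (snd (quotient_of r)) (int p)}"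

text \<open>Congruence in that ring; both sides are required to belong to it.\<close>

definition rat_cong :: "nat \<Rightarrow> rat \<Rightarrow> rat \<Rightarrow> bool" where
  "rat_cong p a b \<longleftrightarrow> a \<in> rats_prime_to p \<and> b \<in> rats_prime_to p \<and>
     (\<exists>c\<in>rats_prime_to p. a - b = of_nat p * c)"

end

theory Submission
  imports Defs "HOL-Computational_Algebra.Formal_Power_Series"
begin

unbundle fps_syntax

text \<open>
  With \<open>F = (1 + 2z)\<^sup>3\<close> the first sum is the coefficient of \<open>z\<^sup>p\<^sup>-\<^sup>1\<close> in
  \<open>S = \<Sum>k<p. z\<^sup>p\<^sup>-\<^sup>1\<^sup>-\<^sup>k F\<^sup>k = (F\<^sup>p - z\<^sup>p) / (F - z)\<close>, and the second one is that coefficient in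
  \<open>(1 + 2z) S\<close>. As \<open>F\<^sup>p \<equiv> 1\<close> modulo \<open>p\<close> and \<open>z\<^sup>p\<close>, only the power series \<open>1 / (F - z)\<close> matters. Now
  \<open>F - z = (1 + z) (1 + 4z + 8z\<^sup>2)\<close>, so partial fractions express its coefficients through powers
  of \<open>-1\<close> and \<open>-2 \<plusminus> 2i\<close>, and the latter are determined modulo \<open>p\<close> by \<open>(1 + i)\<^sup>p \<equiv> 1 + i\<^sup>p\<close>.
\<close>

section \<open>Congruences between rationals with denominator prime to \<open>p\<close>\<close>

text \<open>The reduced denominator divides every other denominator \<open>b\<close> of the same
  fraction, so it inherits coprimality to \<open>p\<close>.\<close>

lemma in_rats_prime_toI:
  assumes "coprime b (int p)" "b \<noteq> 0"
  shows "of_int a / of_int b \<in> rats_prime_to p"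
proof -
  obtain n d where q: "quotient_of (of_int a / of_int b) = (n, d)"
    by fastforce
  have d: "d > 0" and c: "coprime n d"
    using q quotient_of_denom_pos quotient_of_coprime by blast+
  have "(of_int a / of_int b :: rat) = of_int n / of_int d"
    using quotient_of_div[OF q] .
  then have "(of_int (a * d) :: rat) = of_int (n * b)"
    using d assms(2) by (simp add: field_simps)
  then have "a * d = n * b"
    by (simp only: of_int_eq_iff)
  then have "d dvd n * b"
    by (metis dvd_triv_right)
  with c have "d dvd b"
    by (simp add: coprime_commute coprime_dvd_mult_right_iff)
  with assms(1) have "coprime d (int p)"
    by (meson coprime_divisors dvd_refl)
  with q show ?thesis
    by (simp add: rats_prime_to_def)
qed

lemma rat_cong_divideI:
  assumes "coprime b (int p)" "b \<noteq> 0" "[b * a = c] (mod int p)"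
  shows "rat_cong p (of_int a) (of_int c / of_int b)"
proof -
  obtain t where "b * a - c = int p * t"
    using assms(3) by (meson cong_iff_dvd_diff dvdE)
  then have "(of_int (b * a - c) :: rat) = of_int (int p * t)"
    by simp
  then have "(of_int a - of_int c / of_int b :: rat) = of_nat p * (of_int t / of_int b)"
    using assms(2) by (simp add: field_simps)
  moreover have "(of_int a :: rat) \<in> rats_prime_to p"
    using in_rats_prime_toI[of 1 p a] by simp
  ultimately show ?thesis
    unfolding rat_cong_def using in_rats_prime_toI[OF assms(1,2)] by blast
qed

section \<open>Binomial coefficients modulo \<open>p\<close> and powers of linear series\<close>

text \<open>By absorption \<open>j * ((m * p) choose j)\<close> is a multiple of
  \<open>m * p\<close>, while \<open>p\<close> does not divide \<open>j\<close>. The case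
  \<open>m = 3\<close> serves \<open>F ^ p\<close>, the case \<open>m = 1\<close> serves
  \<open>(1 + \<i>) ^ p\<close>.\<close>

lemma prime_dvd_multiple_choose:
  assumes "prime p" "0 < j" "j < p"
  shows "p dvd ((m * p) choose j)"
proof -
  have "p dvd j * ((m * p) choose j)"
    using times_binomial_minus1_eq[OF assms(2), of "m * p"] by simp
  moreover have "\<not> p dvd j"
    using assms(2,3) by (simp add: nat_dvd_not_less)
  ultimately show ?thesis
    using assms(1) prime_dvd_mult_iff by blast
qed

lemma fps_linear_power_nth:
  "(1 + fps_const c * fps_X) ^ m $ j = of_nat (m choose j) * (c::'a::comm_ring_1) ^ j"
proof -
  have "(1 + fps_const c * fps_X) ^ m
      = (\<Sum>k\<le>m. of_nat (m choose k) * (fps_const c * fps_X) ^ k)"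
    by (subst add.commute) (simp add: binomial_ring)
  also have "\<dots> $ j = (\<Sum>k\<le>m. if k = j then of_nat (m choose k) * c ^ k else 0)"
    unfolding fps_sum_nth
    by (intro sum.cong) (auto simp: power_mult_distrib fps_X_power_iff
        simp flip: fps_of_nat mult.assoc)
  finally show ?thesis
    by (simp add: binomial_eq_0)
qed

section \<open>The power series \<open>5 / (F - z)\<close>\<close>

text \<open>The coefficients of \<open>(4 - 8z) / (1 + 4z + 8z\<^sup>2)\<close> in the partial fraction decomposition
  \<open>5 / ((1 + 2z)\<^sup>3 - z) = 1 / (1 + z) + (4 - 8z) / (1 + 4z + 8z\<^sup>2)\<close>.\<close>

fun gseq :: "nat \<Rightarrow> int" where
  "gseq 0 = 4"
| "gseq (Suc 0) = -24"
| "gseq (Suc (Suc n)) = -4 * gseq (Suc n) - 8 * gseq n"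

text \<open>The characteristic roots \<open>-2 + 2 * \<i>\<close> and \<open>-2 - 2 * \<i>\<close>
  of the recurrence both have fourth power -64.\<close>

lemma gseq_add_4: "gseq (n + 4) = -64 * gseq n"
  by (simp add: eval_nat_numeral)

lemma gseq_2_3: "gseq 2 = 64" "gseq 3 = -64"
  by (simp_all add: eval_nat_numeral)

lemma gseq_4_mult: "gseq (4 * m + r) = (-64) ^ m * gseq r"
proof (induction m)
  case (Suc m)
  have "gseq (4 * Suc m + r) = gseq ((4 * m + r) + 4)"
    by (simp add: algebra_simps)
  then show ?case
    using Suc by (simp only: gseq_add_4) simp
qed simp

text \<open>This is \<open>5 / (F - z)\<close>; the factor 5 clears the denominators of the partial
  fractions, so all computations stay in the integers.\<close>

definition qfps :: "int fps" where
  "qfps = Abs_fps (\<lambda>n. (-1) ^ n + gseq n)"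

lemma qfps_inverse: "qfps * ((1 + fps_const 2 * fps_X) ^ 3 - fps_X) = 5"
proof -
  have *: "(1 + fps_const 2 * fps_X) ^ 3 - fps_X
      = (1 + fps_const 5 * fps_X + fps_const 12 * fps_X ^ 2 + fps_const 8 * fps_X ^ 3 :: int fps)"
    by (simp add: power3_eq_cube power2_eq_square algebra_simps fps_numeral_fps_const[symmetric])
  have "(qfps * ((1 + fps_const 2 * fps_X) ^ 3 - fps_X)) $ n = (5 :: int fps) $ n" for n
  proof -
    \<comment> \<open>The cubic reaches three coefficients back, so the first three positions are
      checked by hand and the recurrence settles the others.\<close>
    consider "n = 0" | "n = Suc 0" | "n = Suc (Suc 0)" | k where "n = Suc (Suc (Suc k))"
      by (metis not0_implies_Suc)
    then show ?thesis
      unfolding * by cases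
       (auto simp: distrib_left qfps_def fps_numeral_nth fps_X_power_mult_right_nth
          mult.left_commute[of _ "fps_const _"])
  qed
  then show ?thesis
    by (simp add: fps_eq_iff)
qed

section \<open>The sums as coefficients of a geometric sum\<close>

text \<open>Multiplying by \<open>qfps\<close> replaces the division by \<open>F - z\<close>. The
  factor \<open>t\<close> treats both sums at once: \<open>t = 1\<close> gives the first,
  \<open>t = 1 + 2z\<close> the second.\<close>

lemma diagonal_sum_cong:
  fixes t :: "int fps"
  assumes "prime p"
  shows "[5 * (\<Sum>k<p. ((1 + fps_const 2 * fps_X) ^ (3 * k) * t) $ k) = (qfps * t) $ (p - 1)]
    (mod int p)"
proof -
  define L :: "int fps" where "L = 1 + fps_const 2 * fps_X"
  define S where "S = (\<Sum>k<p. fps_X ^ (p - Suc k) * (L ^ 3) ^ k)"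
  have "5 * (S * t) = (qfps * (L ^ 3 - fps_X)) * (S * t)"
    using qfps_inverse by (simp add: L_def)
  also have "\<dots> = (qfps * t) * ((L ^ 3 - fps_X) * S)"
    by (simp add: mult_ac)
  also have "(L ^ 3 - fps_X) * S = L ^ (3 * p) - fps_X ^ p"
    unfolding S_def by (simp add: power_diff_sumr2[symmetric] power_mult)
  finally have eq: "5 * (S * t) = (qfps * t) * (L ^ (3 * p) - fps_X ^ p)" .
  have "p > 0"
    using assms prime_gt_0_nat by blast
  have "(S * t) $ (p - 1) = (\<Sum>k<p. (fps_X ^ (p - Suc k) * (L ^ (3 * k) * t)) $ (p - 1))"
    by (simp add: S_def sum_distrib_right fps_sum_nth power_mult mult.assoc)
  also have "\<dots> = (\<Sum>k<p. (L ^ (3 * k) * t) $ k)"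
    by (intro sum.cong) (auto simp: fps_X_power_mult_nth)
  finally have S: "(S * t) $ (p - 1) = (\<Sum>k<p. (L ^ (3 * k) * t) $ k)" .
  \<comment> \<open>Only positions below \<open>p\<close> enter coefficient \<open>p - 1\<close> of
    the product. There \<open>fps_X ^ p\<close> is invisible and the binomials
    \<open>(3 * p) choose j\<close> with \<open>j > 0\<close> vanish modulo
    \<open>p\<close>.\<close>
  have coeff: "[(L ^ (3 * p) - fps_X ^ p) $ j = (if j = 0 then 1 else 0)] (mod int p)"
    if "j < p" for j
  proof (cases "j = 0")
    case False
    then have "int p dvd int ((3 * p) choose j)"
      using prime_dvd_multiple_choose[OF assms, of j 3] that by simp
    then show ?thesis
      using False that
      by (simp add: L_def fps_linear_power_nth fps_X_power_iff cong_0_iff)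
  qed (use \<open>p > 0\<close> in \<open>simp add: L_def fps_linear_power_nth fps_X_power_iff\<close>)
  have "5 * (S * t) $ (p - 1)
      = (\<Sum>i=0..p - 1. (L ^ (3 * p) - fps_X ^ p) $ i * (qfps * t) $ (p - 1 - i))"
    using arg_cong[OF eq, of "\<lambda>f. f $ (p - 1)"]
    by (simp only: mult.commute[of "qfps * t"] fps_mult_nth[of "_ - _"] fps_numeral_fps_const
        fps_mult_left_const_nth)
  also have "[\<dots> = (\<Sum>i=0..p - 1. (if i = 0 then 1 else 0) * (qfps * t) $ (p - 1 - i))]
      (mod int p)"
    using \<open>p > 0\<close> by (intro cong_sum cong_mult coeff) auto
  also have "(\<Sum>i=0..p - 1. (if i = 0 then 1 else 0) * (qfps * t) $ (p - 1 - i))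
      = (qfps * t) $ (p - 1)"
    by (simp add: if_distrib[of "\<lambda>x. x * _"] cong: if_cong)
  finally show ?thesis
    unfolding S L_def .
qed

section \<open>Powers of \<open>1 + \<i>\<close> modulo \<open>p\<close>\<close>

lemma Re_i_power: "Re (\<i> ^ j) = of_int (if odd j then 0 else (-1) ^ (j div 2))"
proof (cases "even j")
  case True
  then obtain k where "j = 2 * k" by blast
  then show ?thesis
    by (cases "even k") (auto simp: power_mult)
next
  case False
  then obtain k where "j = Suc (2 * k)" by (metis oddE Suc_eq_plus1)
  then show ?thesis
    by (cases "even k") (auto simp: power_mult)
qed

text \<open>The inner binomials vanish modulo \<open>p\<close>, and \<open>\<i> ^ p\<close> is
  purely imaginary for odd \<open>p\<close>, so only the term \<open>j = 0\<close> survives. Real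
  parts turn this into a statement about integers.\<close>

lemma Re_one_plus_i_power_prime:
  assumes "prime p" "odd p" "Re ((1 + \<i>) ^ p) = of_int a"
  shows "[a = 1] (mod int p)"
proof -
  define r :: "nat \<Rightarrow> int" where "r j = (if odd j then 0 else (-1) ^ (j div 2))" for j
  have "(1 + \<i>) ^ p = (\<Sum>j\<le>p. of_nat (p choose j) * \<i> ^ j)"
    by (subst add.commute) (simp add: binomial_ring)
  then have "of_int a = (\<Sum>j\<le>p. Re (of_nat (p choose j) * \<i> ^ j))"
    using assms(3) by simp
  also have "\<dots> = (\<Sum>j\<le>p. real (p choose j) * Re (\<i> ^ j))"
    by (intro sum.cong) auto
  also have "\<dots> = of_int (\<Sum>j\<le>p. int (p choose j) * r j)"
    by (simp only: Re_i_power r_def) simp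
  finally have a: "a = (\<Sum>j\<le>p. int (p choose j) * r j)"
    by (simp only: of_int_eq_iff)
  have "[(\<Sum>j\<le>p. int (p choose j) * r j) = (\<Sum>j\<le>p. if j = 0 then 1 else 0)] (mod int p)"
  proof (intro cong_sum)
    fix j assume "j \<in> {..p}"
    then consider "j = 0" | "j = p" | "0 < j" "j < p"
      by fastforce
    then show "[int (p choose j) * r j = (if j = 0 then 1 else 0)] (mod int p)"
    proof cases
      case 3
      then have "int p dvd int (p choose j)"
        using prime_dvd_multiple_choose[OF assms(1), of j 1] by simp
      then show ?thesis
        using 3 by (simp add: cong_0_iff)
    qed (use assms(2) prime_gt_0_nat[OF assms(1)] in \<open>auto simp: r_def\<close>)
  qed
  then show ?thesis
    by (simp add: a)
qed

lemma one_plus_i_power_4: "(1 + \<i>) ^ 4 = -4"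
  by (simp add: complex_eq_iff eval_nat_numeral)

text \<open>Since \<open>(1 + \<i>) ^ 4 = -4\<close>, the real part of \<open>(1 + \<i>) ^ p\<close>
  is \<open>(-4) ^ m\<close> times that of \<open>1 + \<i>\<close> or of
  \<open>(1 + \<i>) ^ 3\<close>, which is 1 or -2.\<close>

lemma minus_4_power_cong:
  assumes "prime p"
  shows "p = 4 * m + 1 \<Longrightarrow> [(-4) ^ m = 1] (mod int p)"
    and "p = 4 * m + 3 \<Longrightarrow> [-2 * (-4) ^ m = 1] (mod int p)"
proof -
  have eq: "(1 + \<i>) ^ (4 * m + r) = of_int ((-4) ^ m) * (1 + \<i>) ^ r" for r
    by (simp only: power_add power_mult one_plus_i_power_4) simp
  have cube: "(1 + \<i>) ^ 3 = -2 + 2 * \<i>"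
    by (simp add: complex_eq_iff power3_eq_cube)
  show "[(-4) ^ m = 1] (mod int p)" if "p = 4 * m + 1"
    by (rule Re_one_plus_i_power_prime[OF assms])
       (use that in \<open>simp_all only: eq, simp_all\<close>)
  show "[-2 * (-4) ^ m = 1] (mod int p)" if "p = 4 * m + 3"
    by (rule Re_one_plus_i_power_prime[OF assms])
       (use that in \<open>simp_all only: eq cube, simp_all\<close>)
qed

text \<open>Write -64 as -4 times 16 and remove the powers of 2 by Fermat. For
  \<open>p = 4 * m + 3\<close> the exponent \<open>p - 1 = 4 * m + 2\<close> leaves an extra factor
  4, which turns -2 into -8.\<close>

lemma minus_64_power_cong:
  assumes "prime p" "odd p"
  shows "p = 4 * m + 1 \<Longrightarrow> [(-64) ^ m = 1] (mod int p)"
    and "p = 4 * m + 3 \<Longrightarrow> [8 * (-64) ^ m = -1] (mod int p)"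
proof -
  have "\<not> p dvd 2"
    using assms primes_dvd_imp_eq two_is_prime_nat by blast
  then have fermat: "[2 ^ (p - 1) = 1] (mod int p)"
    using fermat_theorem[OF assms(1), of 2]
    by (metis cong_int_iff of_nat_1 of_nat_numeral of_nat_power)
  have eq: "(-64 :: int) ^ m = (-4) ^ m * 2 ^ (4 * m)"
    by (simp add: power_mult flip: power_mult_distrib)
  show "[(-64) ^ m = 1] (mod int p)" if "p = 4 * m + 1"
    using cong_mult[OF minus_4_power_cong(1)[OF assms(1) that] fermat] that by (simp add: eq)
  show "[8 * (-64) ^ m = -1] (mod int p)" if "p = 4 * m + 3"
  proof -
    have "p - 1 = 4 * m + 2"
      using that by simp
    with cong_mult[OF minus_4_power_cong(2)[OF assms(1) that] fermat]
    have "[-(8 * (-64) ^ m) = 1] (mod int p)"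
      by (simp add: eq power_add mult_ac)
    then show ?thesis
      by (metis cong_minus_minus_iff minus_minus)
  qed
qed

section \<open>The coefficients of \<open>qfps\<close> just below \<open>p\<close>\<close>

lemma qfps_nth_pred_prime:
  assumes "prime p" "odd p"
  shows "[qfps $ (p - 1) = 6 * (-1) ^ ((p - 1) div 2) - 1] (mod int p)"
    and "[qfps $ (p - 1) + 2 * qfps $ (p - 2) = 4 * (-1) ^ ((p - 1) div 2) + 1] (mod int p)"
proof -
  have "p > 2"
    using assms prime_ge_2_nat[of p] by (cases "p = 2") auto
  have "p mod 4 = 1 \<or> p mod 4 = 3"
    using assms(2) by presburger
  \<comment> \<open>\<open>Suc k\<close> in the first case lets the index \<open>p - 2\<close> be
    written as \<open>4 * k + 3\<close>.\<close>
  then consider k where "p = 4 * Suc k + 1" | k where "p = 4 * k + 3"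
    using \<open>p > 2\<close>
    by (metis div_mod_decomp mult.commute not0_implies_Suc mult_0_right add_0 numeral_2_eq_2
        Suc_lessD less_irrefl One_nat_def)
  then have "[qfps $ (p - 1) = 6 * (-1) ^ ((p - 1) div 2) - 1] (mod int p) \<and>
    [qfps $ (p - 1) + 2 * qfps $ (p - 2) = 4 * (-1) ^ ((p - 1) div 2) + 1] (mod int p)"
  proof cases
    case 1
    define x :: int where "x = (-64) ^ Suc k"
    have p: "p - 1 = 4 * Suc k + 0" "p - 2 = 4 * k + 3" "(p - 1) div 2 = 2 * Suc k"
      using 1 by auto
    have q1: "qfps $ (p - 1) = 1 + 4 * x"
      unfolding qfps_def p fps_nth_Abs_fps gseq_4_mult by (simp add: x_def)
    have q2: "qfps $ (p - 2) = x - 1"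
      unfolding qfps_def p fps_nth_Abs_fps gseq_4_mult by (simp add: x_def gseq_2_3 power_add)
    have "int p dvd x - 1"
      using minus_64_power_cong(1)[OF assms 1] by (simp add: x_def cong_iff_dvd_diff)
    \<comment> \<open>These multiples are exactly the differences of the two sides in the two
      claims.\<close>
    then have "int p dvd 4 * (x - 1)" "int p dvd 6 * (x - 1)"
      by (rule dvd_mult)+
    then show ?thesis
      unfolding q1 q2 p(3) by (simp add: cong_iff_dvd_diff algebra_simps)
  next
    case 2
    define x :: int where "x = (-64) ^ k"
    have p: "p - 1 = 4 * k + 2" "p - 2 = 4 * k + 1" "(p - 1) div 2 = 2 * k + 1"
      using 2 by auto
    have q1: "qfps $ (p - 1) = 1 + 64 * x"
      unfolding qfps_def p fps_nth_Abs_fps gseq_4_mult by (simp add: x_def gseq_2_3)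
    have q2: "qfps $ (p - 2) = -1 - 24 * x"
      unfolding qfps_def p fps_nth_Abs_fps gseq_4_mult by (simp add: x_def)
    have "int p dvd 8 * x + 1"
      using minus_64_power_cong(2)[OF assms 2] by (simp add: x_def cong_iff_dvd_diff)
    then have "int p dvd 8 * (8 * x + 1)" "int p dvd 2 * (8 * x + 1)"
      by (rule dvd_mult)+
    then show ?thesis
      unfolding q1 q2 p(3) by (simp add: cong_iff_dvd_diff algebra_simps)
  qed
  then show "[qfps $ (p - 1) = 6 * (-1) ^ ((p - 1) div 2) - 1] (mod int p)"
    and "[qfps $ (p - 1) + 2 * qfps $ (p - 2) = 4 * (-1) ^ ((p - 1) div 2) + 1] (mod int p)"
    by blast+
qed

theorem theorem1p2:
  fixes p :: nat
  assumes "prime p" and "p > 5"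
  shows "rat_cong p (\<Sum>k=0..p-1. 2 ^ k * of_nat ((3 * k) choose k))
           ((6 * (-1) ^ ((p - 1) div 2) - 1) / 5) \<and>
         rat_cong p (\<Sum>k=0..p-1. 2 ^ k * of_nat ((3 * k + 1) choose k))
           ((4 * (-1) ^ ((p - 1) div 2) + 1) / 5)"
proof -
  have "odd p"
    using assms prime_odd_nat by simp
  have "coprime (int 5) (int p)"
    using assms primes_coprime[of "5::nat" p] by (simp only: coprime_int_iff) simp
  then have cop: "coprime 5 (int p)"
    by simp
  define a b :: int where "a = (\<Sum>k<p. 2 ^ k * int ((3 * k) choose k))"
    and "b = (\<Sum>k<p. 2 ^ k * int ((3 * k + 1) choose k))"
  have range: "{0..p-1} = {..<p}"
    using assms by auto
  have "(qfps * (1 + fps_const 2 * fps_X)) $ (p - 1) = qfps $ (p - 1) + 2 * qfps $ (p - 2)"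
    using assms
    by (simp add: distrib_left mult.left_commute[of _ "fps_const _"] numeral_2_eq_2)
  \<comment> \<open>The extra factor \<open>1 + 2z\<close> raises the exponent \<open>3 * k\<close>
    to \<open>3 * k + 1\<close>, and it brings in coefficient \<open>p - 2\<close> of
    \<open>qfps\<close>.\<close>
  with diagonal_sum_cong[OF assms(1), of "1 + fps_const 2 * fps_X"]
  have b: "[5 * b = qfps $ (p - 1) + 2 * qfps $ (p - 2)] (mod int p)"
    by (simp only: power_Suc2[symmetric] fps_linear_power_nth b_def Suc_eq_plus1
        mult.commute[of "of_nat _"])
  from diagonal_sum_cong[OF assms(1), of 1]
  have a: "[5 * a = qfps $ (p - 1)] (mod int p)"
    by (simp add: fps_linear_power_nth a_def mult.commute[of "of_nat _"])
  have "rat_cong p (of_int a) (of_int (6 * (-1) ^ ((p - 1) div 2) - 1) / of_int 5)"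
    using cong_trans[OF a qfps_nth_pred_prime(1)[OF assms(1) \<open>odd p\<close>]]
    by (intro rat_cong_divideI cop) auto
  moreover have "rat_cong p (of_int b) (of_int (4 * (-1) ^ ((p - 1) div 2) + 1) / of_int 5)"
    using cong_trans[OF b qfps_nth_pred_prime(2)[OF assms(1) \<open>odd p\<close>]]
    by (intro rat_cong_divideI cop) auto
  ultimately show ?thesis
    unfolding range by (simp add: a_def b_def)
qed

end
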